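(* Seidel matrices of order $18$ with spectrum $\{[-9]^3,[1]^9,[3]^6\}$ do not exist.
   Context: A Seidel matrix of order $n$ is an $n\times n$ symmetric matrix with zero diagonal and all off-diagonal entries equal to $\pm1$. The spectrum is the multiset of eigenvalues, and $[\lambda]^a$ means that the eigenvalue $\lambda$ has multiplicity $a$. *)

theory Defs
  imports "Jordan_Normal_Form.Char_Poly"
begin

definition seidel_matrix :: "nat \<Rightarrow> real mat \<Rightarrow> bool" where
  "seidel_matrix n S \<longleftrightarrow>
     S \<in> carrier_mat n n \<and>
     transpose_mat S = S \<and>
     (\<forall>i<n. S $$ (i, i) = 0) \<and>
     (\<forall>i<n. \<forall>j<n. i \<noteq> j \<longrightarrow> S $$ (i, j) = 1 \<or> S $$ (i, j) = -1)"

text \<open>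
  The multiset of eigenvalues, counted with multiplicity as roots of the characteristic
  polynomial. Only real eigenvalues are counted; a real symmetric matrix has no others, and
  its algebraic and geometric multiplicities agree. The name avoids the constant
  \<open>spectrum\<close> of \<open>Jordan_Normal_Form\<close>, which is a set and forgets multiplicities.
\<close>
definition spectrum_mset :: "real mat \<Rightarrow> real multiset" where
  "spectrum_mset A = proots (char_poly A)"

lemma set_spectrum_mset:
  assumes "A \<in> carrier_mat n n"
  shows "set_mset (spectrum_mset A) = {k. eigenvalue A k}"
proof -
  have "char_poly A \<noteq> 0"
    using degree_monic_char_poly[OF assms] by auto
  then show ?thesis
    by (simp add: spectrum_mset_def eigenvalue_root_char_poly[OF assms])
qed

end

theory Submission
  imports Defs
begin

text \<open>
  Let \<open>M = (S - 1)(S - 3)\<close>, which is 120 times the projection onto the three-dimensional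
  eigenspace of \<open>-9\<close>. Its entries are integers, and counting the entries that are 2 modulo 4
  shows that there are none, so \<open>M = 4 L\<close> with \<open>L\<close> the integral Gram matrix of 18 vectors of
  squared norm 5 in three-space. The matrix \<open>L + 3 S - 3\<close> is 6 times the projection onto the eigenspace
  of 3, which forces \<open>\<bar>L\<^sub>i\<^sub>j + 3 S\<^sub>i\<^sub>j\<bar> \<le> 2\<close> off the diagonal. Together with the diagonal
  entries of \<open>L\<^sup>2 = 30 L\<close> and \<open>S L = -9 L\<close> this gives, in each row, at least nine entries of
  absolute value 3 and none of absolute value 5 off the diagonal. Fix a row \<open>i\<close>, change signs so that
  nine of the vectors have inner product 3 with the \<open>i\<close>-th one, and project them to its orthogonal
  plane. The vanishing of the \<open>3 \<times> 3\<close> Gram determinants there forces each triple of the nine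
  vectors to contain exactly one pair with inner product \<open>-1\<close>; counting such pairs among five
  vectors gives \<open>10 / 3\<close>.
\<close>

section \<open>Orthogonal diagonalization of real symmetric matrices\<close>

text \<open>The reflection in the hyperplane orthogonal to v - e_0 exchanges the unit vectors v and
  e_0. It completes a unit eigenvector to an orthogonal matrix in place of a Gram-Schmidt
  process.\<close>

lemma householder_reflection:
  fixes v :: "real vec"
  assumes v: "v \<in> carrier_vec n" and norm: "v \<bullet> v = 1" and n: "0 < n"
  shows "\<exists>H \<in> carrier_mat n n. transpose_mat H = H \<and> H * H = 1\<^sub>m n \<and> col H 0 = v"
proof -
  define w where "w = (\<lambda>i. v $ i - (if i = 0 then 1 else 0))"
  \<comment> \<open>For v = e_0 the division by zero gives c = 0, so \<open>H\<close> is the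
    identity; \<open>cc\<close> below holds in both cases.\<close>
  define c where "c = 2 / (\<Sum>k<n. w k * w k)"
  define H where "H = mat n n (\<lambda>(i, j). (if i = j then 1 else 0) - c * w i * w j)"
  have vv: "(\<Sum>k<n. v $ k * v $ k) = 1"
    using norm v by (simp add: scalar_prod_def atLeast0LessThan)
  have "(\<Sum>k<n. w k * w k) =
      (\<Sum>k<n. v $ k * v $ k - 2 * (if k = 0 then v $ k else 0) + (if k = 0 then 1 else 0))"
    by (intro sum.cong) (auto simp: w_def algebra_simps)
  also have "\<dots> = 2 - 2 * v $ 0"
    using n by (simp add: sum.distrib sum_subtractf vv sum_distrib_left[symmetric])
  finally have ww: "(\<Sum>k<n. w k * w k) = 2 - 2 * v $ 0" .
  have cc: "c * c * (\<Sum>k<n. w k * w k) = 2 * c"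
    by (simp add: c_def)
  have H: "H \<in> carrier_mat n n" by (simp add: H_def)
  have "H * H = 1\<^sub>m n"
  proof (rule eq_matI)
    fix i j assume ij: "i < dim_row (1\<^sub>m n)" "j < dim_col (1\<^sub>m n)"
    then have "(H * H) $$ (i, j) =
        (\<Sum>k<n. ((if i = k then 1 else 0) - c * w i * w k) * ((if k = j then 1 else 0) - c * w k * w j))"
      by (simp add: H_def scalar_prod_def atLeast0LessThan)
    also have "\<dots> = (\<Sum>k<n. (if k = i then (if i = j then 1 else 0) else 0)
        - (if k = i then c * w i * w j else 0) - (if k = j then c * w i * w j else 0)
        + c * c * w i * w j * (w k * w k))"
      by (intro sum.cong) (auto simp: algebra_simps)
    also have "\<dots> = (if i = j then 1 else 0) - 2 * c * w i * w j
        + (c * c * (\<Sum>k<n. w k * w k)) * w i * w j"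
      using ij by (simp add: sum.distrib sum_subtractf flip: sum_distrib_left)
    also have "\<dots> = (if i = j then 1 else 0)"
      unfolding cc by simp
    finally show "(H * H) $$ (i, j) = 1\<^sub>m n $$ (i, j)"
      using ij by simp
  qed (auto simp: H_def)
  moreover have "transpose_mat H = H"
    by (rule eq_matI) (auto simp: H_def)
  moreover have "col H 0 = v"
  proof (rule eq_vecI)
    fix i assume "i < dim_vec v"
    then have i: "i < n" using v by auto
    have "c * w i * w 0 = - w i"
    proof (cases "v $ 0 = 1")
      case True
      then have "(\<Sum>k<n. w k * w k) = 0" using ww by simp
      then have "\<forall>k\<in>{..<n}. w k * w k = 0"
        by (subst (asm) sum_nonneg_eq_0_iff) auto
      then have "w i = 0" using i by auto
      then show ?thesis by simp
    next
      case False
      then show ?thesis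
        unfolding c_def ww by (simp add: w_def divide_simps) (simp add: algebra_simps)
    qed
    then show "col H 0 $ i = v $ i"
      using i n by (simp add: H_def) (simp add: w_def)
  qed (use v in \<open>auto simp: H_def\<close>)
  ultimately show ?thesis using H by blast
qed

text \<open>Deflation: after conjugation by a reflection taking e_0 to a unit eigenvector, the first
  column is a multiple of e_0, symmetry clears the first row, and the remaining block is handled by
  induction. The diagonal keeps the order of \<open>es\<close>, so that index ranges can later stand
  for eigenspaces.\<close>

lemma symmetric_mat_orthogonally_diagonalizable:
  fixes A :: "real mat"
  assumes "A \<in> carrier_mat n n" and "transpose_mat A = A"
    and "char_poly A = (\<Prod>e\<leftarrow>es. [:- e, 1:])"
  shows "\<exists>U \<in> carrier_mat n n. transpose_mat U * U = 1\<^sub>m n \<and>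
    A = U * mat_diag n (\<lambda>i. es ! i) * transpose_mat U"
  using assms
proof (induction es arbitrary: n A)
  case Nil
  then have "n = 0" using degree_monic_char_poly[of A n] by auto
  then show ?case using Nil by (intro bexI[of _ "1\<^sub>m 0"]) auto
next
  case (Cons e es)
  note A = Cons.prems(1)
  have cp: "char_poly A = [:- e, 1:] * (\<Prod>e\<leftarrow>es. [:- e, 1:])"
    using Cons.prems(3) by simp
  have "monic (\<Prod>e\<leftarrow>es. [:- e, 1:])" by (rule monic_prod_list) auto
  then have "degree (char_poly A) = Suc (degree (\<Prod>e\<leftarrow>es. [:- e, 1:]))"
    unfolding cp by (subst degree_mult_eq) auto
  then have n: "n \<noteq> 0" using degree_monic_char_poly[OF A] by auto
  define m where "m = n - 1"
  have nm: "n = 1 + m" using n by (simp add: m_def)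
  have "eigenvalue A e"
    unfolding eigenvalue_root_char_poly[OF A] cp by simp
  then obtain x where x: "x \<in> carrier_vec n" "x \<noteq> 0\<^sub>v n" "A *\<^sub>v x = e \<cdot>\<^sub>v x"
    using A by (auto simp: eigenvalue_def eigenvector_def)
  have "x \<bullet> x > 0"
  proof -
    obtain k where k: "k < n" "x $ k \<noteq> 0"
      using x(1,2) by (metis carrier_vecD eq_vecI index_zero_vec)
    then have "0 < x $ k * x $ k"
      using not_real_square_gt_zero by blast
    also have "\<dots> \<le> (\<Sum>k<n. x $ k * x $ k)"
      using k by (intro member_le_sum) auto
    finally show ?thesis
      using x(1) by (simp add: scalar_prod_def atLeast0LessThan)
  qed
  define v where "v = (1 / sqrt (x \<bullet> x)) \<cdot>\<^sub>v x"
  have v: "v \<in> carrier_vec n" using x by (simp add: v_def)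
  have "v \<bullet> v = 1"
    using x(1) \<open>x \<bullet> x > 0\<close> by (simp add: v_def)
  have Av: "A *\<^sub>v v = e \<cdot>\<^sub>v v"
    using x A by (simp add: v_def mult_mat_vec smult_smult_assoc mult.commute)
  obtain H where H: "H \<in> carrier_mat n n" "transpose_mat H = H" "H * H = 1\<^sub>m n" "col H 0 = v"
    using householder_reflection[OF v \<open>v \<bullet> v = 1\<close>] n by auto
  define B where "B = H * A * H"
  have B: "B \<in> carrier_mat n n" using H A by (simp add: B_def)
  have Bt: "transpose_mat B = B"
    using H A Cons.prems(2)
    by (simp add: B_def transpose_mult[of _ n n _ n] assoc_mult_mat[of _ n n _ n _ n])
  have "col B 0 = (H * A) *\<^sub>v v"
    unfolding B_def using H n A by (subst col_mult2[of _ n n _ n]) auto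
  also have "\<dots> = H *\<^sub>v (e \<cdot>\<^sub>v v)"
    using H A v Av by (subst assoc_mult_mat_vec[of _ n n _ n]) auto
  also have "\<dots> = e \<cdot>\<^sub>v (H *\<^sub>v v)"
    using H v by (simp add: mult_mat_vec)
  also have "H *\<^sub>v v = col (H * H) 0"
    using H n by (subst col_mult2[of _ n n _ n]) auto
  finally have col0: "col B 0 = e \<cdot>\<^sub>v col (1\<^sub>m n) 0" using H by simp
  have B0: "B $$ (i, 0) = (if i = 0 then e else 0)" if "i < n" for i
    using arg_cong[OF col0, of "\<lambda>w. w $ i"] that B n by auto
  have B0': "B $$ (0, i) = (if i = 0 then e else 0)" if "i < n" for i
    using B0[OF that] Bt that B n by (metis carrier_matD index_transpose_mat(1) neq0_conv)
  define C where "C = mat m m (\<lambda>(i, j). B $$ (Suc i, Suc j))"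
  define E where "E = mat 1 1 (\<lambda>_. e)"
  have C: "C \<in> carrier_mat m m" and E: "E \<in> carrier_mat 1 1" by (simp_all add: C_def E_def)
  have BC: "B = four_block_mat E (0\<^sub>m 1 m) (0\<^sub>m m 1) C"
    by (rule eq_matI) (use B nm B0 B0' in \<open>auto simp: C_def E_def\<close>)
  have "C = transpose_mat C"
    by (rule eq_matI) (use B nm Bt in \<open>auto simp: C_def\<close>, metis Suc_less_eq carrier_matD index_transpose_mat(1) plus_1_eq_Suc)
  \<comment> \<open>\<open>H\<close> is its own inverse, so conjugation preserves the characteristic
    polynomial, and cancelling the factor of \<open>E\<close> leaves that of
    \<open>C\<close>.\<close>
  have "similar_mat A B"
    by (rule similar_matI[of _ _ H H n])
      (use H A B in \<open>auto simp: B_def assoc_mult_mat[of _ n n _ n _ n]\<close>,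
       metis H(1) assoc_mult_mat left_mult_one_mat mult_carrier_mat)
  then have "char_poly A = char_poly E * char_poly C"
    unfolding BC by (subst char_poly_similar, assumption) (rule char_poly_four_block_zeros_col[OF E _ C], simp)
  moreover have "char_poly E = [:- e, 1:]"
    by (simp add: E_def char_poly_defs det_def sign_def)
  ultimately have "char_poly C = (\<Prod>e\<leftarrow>es. [:- e, 1:])"
    using cp by (metis mult_cancel_left pCons_eq_0_iff zero_neq_one)
  from Cons.IH[OF C \<open>C = transpose_mat C\<close>[symmetric] this]
  obtain V where V: "V \<in> carrier_mat m m" "transpose_mat V * V = 1\<^sub>m m"
    and CV: "C = V * mat_diag m (\<lambda>i. es ! i) * transpose_mat V" by blast
  define W where "W = four_block_mat (1\<^sub>m 1) (0\<^sub>m 1 m) (0\<^sub>m m 1) V"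
  define D where "D = mat_diag n (\<lambda>i. (e # es) ! i)"
  have W: "W \<in> carrier_mat n n" and D: "D \<in> carrier_mat n n"
    using V nm by (auto simp: W_def D_def)
  have Wt: "transpose_mat W = four_block_mat (1\<^sub>m 1) (0\<^sub>m 1 m) (0\<^sub>m m 1) (transpose_mat V)"
    unfolding W_def using V by (subst transpose_four_block_mat[of _ 1 1 _ m _ m]) auto
  have WW: "transpose_mat W * W = 1\<^sub>m n"
    unfolding Wt unfolding W_def using V nm
    by (subst mult_four_block_mat[of _ 1 1 _ m _ m _ _ 1 _ m]) auto
  have DB: "D = four_block_mat E (0\<^sub>m 1 m) (0\<^sub>m m 1) (mat_diag m (\<lambda>i. es ! i))"
    by (rule eq_matI) (use nm in \<open>auto simp: D_def E_def mat_diag_def nth_Cons'\<close>)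
  have G: "mat_diag m (\<lambda>i. es ! i) \<in> carrier_mat m m" by simp
  have WD: "W * D = four_block_mat E (0\<^sub>m 1 m) (0\<^sub>m m 1) (V * mat_diag m (\<lambda>i. es ! i))"
    unfolding W_def DB using V E G
    by (subst mult_four_block_mat[of _ 1 1 _ m _ m _ _ 1 _ m])
       (auto simp: left_mult_zero_mat[OF G] right_add_zero_mat[of _ m m] left_add_zero_mat[of _ m m])
  have VG: "V * mat_diag m (\<lambda>i. es ! i) \<in> carrier_mat m m" using V by simp
  have BW: "B = W * D * transpose_mat W"
    unfolding Wt WD BC CV using V E VG
    by (subst mult_four_block_mat[of _ 1 1 _ m _ m _ _ 1 _ m])
       (auto simp: right_mult_zero_mat[OF VG] left_add_zero_mat[of _ m m])
  define U where "U = H * W"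
  have U: "U \<in> carrier_mat n n" using H W by (simp add: U_def)
  have Ut: "transpose_mat U = transpose_mat W * H"
    using H W by (simp add: U_def transpose_mult[of _ n n _ n])
  have "transpose_mat U * U = transpose_mat W * (H * H) * W"
    unfolding Ut using H(1) W by (simp add: U_def assoc_mult_mat[of _ n n _ n _ n])
  then have UU: "transpose_mat U * U = 1\<^sub>m n" using H W WW by simp
  have "A = (H * H) * A * (H * H)" using H A by simp
  also have "\<dots> = H * B * H"
    unfolding B_def using H(1) A by (simp add: assoc_mult_mat[of _ n n _ n _ n])
  also have "\<dots> = U * D * transpose_mat U"
    unfolding BW Ut unfolding U_def using H(1) W D by (simp add: assoc_mult_mat[of _ n n _ n _ n])
  finally show ?case using U UU unfolding D_def by blast
qed

section \<open>Gram determinants in three-space\<close>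

text \<open>With the three vectors as rows of M, both sides are det (M M^T).\<close>

lemma gram_det_square:
  fixes a0 a1 a2 b0 b1 b2 c0 c1 c2 :: "real"
  shows "(a0 * (b1 * c2 - b2 * c1) - a1 * (b0 * c2 - b2 * c0) + a2 * (b0 * c1 - b1 * c0))\<^sup>2 =
    (a0 * a0 + a1 * a1 + a2 * a2) * (b0 * b0 + b1 * b1 + b2 * b2) * (c0 * c0 + c1 * c1 + c2 * c2)
    + 2 * (a0 * b0 + a1 * b1 + a2 * b2) * (a0 * c0 + a1 * c1 + a2 * c2) * (b0 * c0 + b1 * c1 + b2 * c2)
    - (a0 * a0 + a1 * a1 + a2 * a2) * (b0 * c0 + b1 * c1 + b2 * c2)\<^sup>2
    - (b0 * b0 + b1 * b1 + b2 * b2) * (a0 * c0 + a1 * c1 + a2 * c2)\<^sup>2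
    - (c0 * c0 + c1 * c1 + c2 * c2) * (a0 * b0 + a1 * b1 + a2 * b2)\<^sup>2"
 by (simp add: algebra_simps power2_eq_square)

text \<open>The orthogonal complement of a nonzero vector in three-space is a plane, where any three
  vectors are dependent.\<close>

lemma planar_gram_det:
  fixes v w1 w2 w3 :: "nat \<Rightarrow> real"
  defines "ip \<equiv> \<lambda>x y. \<Sum>a<3. x a * y a"
  assumes v: "ip v v = c" "c \<noteq> 0" and o: "ip v w1 = 0" "ip v w2 = 0" "ip v w3 = 0"
  shows "ip w1 w1 * ip w2 w2 * ip w3 w3 + 2 * ip w1 w2 * ip w1 w3 * ip w2 w3
     - ip w1 w1 * (ip w2 w3)\<^sup>2 - ip w2 w2 * (ip w1 w3)\<^sup>2 - ip w3 w3 * (ip w1 w2)\<^sup>2 = 0"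
proof -
  have ip: "ip x y = x 0 * y 0 + x 1 * y 1 + x 2 * y 2" for x y
    by (simp add: ip_def eval_nat_numeral)
  define d where "d = w1 0 * (w2 1 * w3 2 - w2 2 * w3 1) - w1 1 * (w2 0 * w3 2 - w2 2 * w3 0)
    + w1 2 * (w2 0 * w3 1 - w2 1 * w3 0)"
  \<comment> \<open>Cramer's rule: the adjugate of the matrix with rows w1, w2, w3, applied to the
    inner products of these rows with v, gives d v.\<close>
  have "v 0 * d = ip v w1 * (w2 1 * w3 2 - w2 2 * w3 1) - ip v w2 * (w1 1 * w3 2 - w1 2 * w3 1)
      + ip v w3 * (w1 1 * w2 2 - w1 2 * w2 1)"
    "v 1 * d = - ip v w1 * (w2 0 * w3 2 - w2 2 * w3 0) + ip v w2 * (w1 0 * w3 2 - w1 2 * w3 0)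
      - ip v w3 * (w1 0 * w2 2 - w1 2 * w2 0)"
    "v 2 * d = ip v w1 * (w2 0 * w3 1 - w2 1 * w3 0) - ip v w2 * (w1 0 * w3 1 - w1 1 * w3 0)
      + ip v w3 * (w1 0 * w2 1 - w1 1 * w2 0)"
    unfolding ip d_def by (simp_all add: algebra_simps)
  then have "v 0 * d = 0" "v 1 * d = 0" "v 2 * d = 0" by (simp_all add: o)
  then have "d = 0" using v by (auto simp: ip)
  moreover have "ip w1 w1 * ip w2 w2 * ip w3 w3 + 2 * ip w1 w2 * ip w1 w3 * ip w2 w3
     - ip w1 w1 * (ip w2 w3)\<^sup>2 - ip w2 w2 * (ip w1 w3)\<^sup>2 - ip w3 w3 * (ip w1 w2)\<^sup>2 = d\<^sup>2"
    unfolding ip d_def by (rule gram_det_square[symmetric])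
  ultimately show ?thesis by simp
qed

text \<open>A finite check of 512 triples. The equation is the vanishing Gram determinant produced
  by \<open>gram_equation\<close>.\<close>

lemma planar_triple:
  fixes x y z :: int
  assumes "x \<in> {-4..4} - {0}" "y \<in> {-4..4} - {0}" "z \<in> {-4..4} - {0}"
    and "4096 + 2 * (5 * x - 9) * (5 * y - 9) * (5 * z - 9)
      = 16 * ((5 * x - 9)\<^sup>2 + (5 * y - 9)\<^sup>2 + (5 * z - 9)\<^sup>2)"
  shows "of_bool (x = -1) + of_bool (y = -1) + of_bool (z = -1) = (1 :: int)"
proof -
  have "{-4..4} - {0} = set [-4, -3, -2, -1, 1, 2, 3, 4 :: int]" by auto
  moreover have "\<forall>x \<in> set [-4, -3, -2, -1, 1, 2, 3, 4 :: int].
      \<forall>y \<in> set [-4, -3, -2, -1, 1, 2, 3, 4 :: int]. \<forall>z \<in> set [-4, -3, -2, -1, 1, 2, 3, 4 :: int].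
      4096 + 2 * (5 * x - 9) * (5 * y - 9) * (5 * z - 9)
        = 16 * ((5 * x - 9)\<^sup>2 + (5 * y - 9)\<^sup>2 + (5 * z - 9)\<^sup>2) \<longrightarrow>
      of_bool (x = -1) + of_bool (y = -1) + of_bool (z = -1) = (1 :: int)"
    by code_simp
  ultimately show ?thesis using assms by (simp only:)
qed

section \<open>Counting lemmas, and polynomials with prescribed roots\<close>

text \<open>Among five elements, summing over the ten triples counts each pair three times, so 10
  would be a multiple of 3.\<close>

lemma card_le_4_if_one_per_triple:
  fixes P :: "'a \<Rightarrow> 'a \<Rightarrow> bool"
  assumes fin: "finite K"
    and triple: "\<And>k l m. k \<in> K \<Longrightarrow> l \<in> K \<Longrightarrow> m \<in> K \<Longrightarrow> distinct [k, l, m] \<Longrightarrow>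
      of_bool (P k l) + of_bool (P k m) + of_bool (P l m) = (1 :: int)"
  shows "card K \<le> 4"
proof (rule ccontr)
  assume "\<not> card K \<le> 4"
  then obtain F where F: "F \<subseteq> K" "card F = 5" "finite F"
    using obtain_subset_with_card_n[of 5 K] by auto
  then obtain xs where xs: "set xs = F" "distinct xs"
    using finite_distinct_list by blast
  then have "length xs = 5" using F distinct_card by force
  then obtain a b c d e where "xs = [a, b, c, d, e]"
    by (auto simp: length_Suc_conv eval_nat_numeral)
  with xs F have K: "a \<in> K" "b \<in> K" "c \<in> K" "d \<in> K" "e \<in> K" and dist: "distinct [a, b, c, d, e]"
    by auto
  define p where "p = (\<lambda>k l. of_bool (P k l) :: int)"
  have p: "p k l + p k m + p l m = 1" if "k \<in> K" "l \<in> K" "m \<in> K" "distinct [k, l, m]" for k l m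
    unfolding p_def by (rule triple) (use that in auto)
  have "3 * (p a b + p a c + p a d + p a e + p b c + p b d + p b e + p c d + p c e + p d e)
    = (p a b + p a c + p b c) + (p a b + p a d + p b d) + (p a b + p a e + p b e)
      + (p a c + p a d + p c d) + (p a c + p a e + p c e) + (p a d + p a e + p d e)
      + (p b c + p b d + p c d) + (p b c + p b e + p c e) + (p b d + p b e + p d e)
      + (p c d + p c e + p d e)"
    by simp
  also have "\<dots> = 10"
    using K dist by (simp add: p)
  finally show False by presburger
qed

text \<open>With m minus signs the expression is 1 - 2 m - (-1)^m, which is a multiple of 4 for
  either parity of m.\<close>

lemma sum_signs_mod_4:
  fixes f :: "'a \<Rightarrow> int"
  assumes "finite A" "\<And>k. k \<in> A \<Longrightarrow> f k = 1 \<or> f k = -1"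
  shows "4 dvd (\<Sum>k\<in>A. f k) - int (card A) + 1 - (\<Prod>k\<in>A. f k)"
  using assms
proof (induction A rule: finite_induct)
  case (insert k A)
  have "\<forall>k\<in>A. \<bar>f k\<bar> = 1"
    using insert.prems by fastforce
  then have "\<bar>\<Prod>k\<in>A. f k\<bar> = 1"
    by (simp add: abs_prod)
  then have "(\<Prod>k\<in>A. f k) = 1 \<or> (\<Prod>k\<in>A. f k) = -1"
    by linarith
  moreover have "f k = 1 \<or> f k = -1"
    using insert.prems by simp
  ultimately have "(\<Sum>k\<in>insert k A. f k) - int (card (insert k A)) + 1 - (\<Prod>k\<in>insert k A. f k)
        \<in> (\<lambda>x. (\<Sum>k\<in>A. f k) - int (card A) + 1 - (\<Prod>k\<in>A. f k) - x) ` {0, 4}"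
    using insert.hyps by auto
  moreover have "4 dvd (\<Sum>k\<in>A. f k) - int (card A) + 1 - (\<Prod>k\<in>A. f k)"
    using insert.IH insert.prems by simp
  ultimately show ?case
    by (elim imageE insertE; simp only: diff_0_right dvd_diff dvd_refl) simp_all
qed simp

text \<open>For an integer z the value z^2 + z is nonnegative. These values add up to 2, while z = 2
  alone would contribute 6. Each nonzero z adds at least 1 to the sum of squares, so at most eight
  are nonzero.\<close>

lemma many_deviations_zero:
  fixes z :: "'a \<Rightarrow> int"
  assumes fin: "finite J" and bound: "\<And>j. j \<in> J \<Longrightarrow> \<bar>z j\<bar> \<le> 2"
    and sum: "(\<Sum>j\<in>J. z j) = -6" and squares: "(\<Sum>j\<in>J. (z j)\<^sup>2) = 8"
  shows "\<And>j. j \<in> J \<Longrightarrow> z j \<le> 1" and "card J \<le> card {j \<in> J. z j = 0} + 8"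
proof -
  have total: "(\<Sum>j\<in>J. (z j)\<^sup>2 + z j) = 2"
    by (simp add: sum.distrib sum squares)
  have nonneg: "0 \<le> (z j)\<^sup>2 + z j" for j
  proof (cases "z j \<ge> 0")
    case False
    then have "0 \<le> z j * (z j + 1)" by (intro mult_nonpos_nonpos) auto
    then show ?thesis by (simp add: power2_eq_square algebra_simps)
  qed simp
  show "z j \<le> 1" if j: "j \<in> J" for j
  proof (rule ccontr)
    assume "\<not> z j \<le> 1"
    then have "z j = 2" using bound[OF j] by auto
    moreover have "(z j)\<^sup>2 + z j \<le> (\<Sum>j\<in>J. (z j)\<^sup>2 + z j)"
      using fin j nonneg by (intro member_le_sum) auto
    ultimately show False using total by simp
  qed
  have "int (card {j \<in> J. z j \<noteq> 0}) = (\<Sum>j\<in>{j \<in> J. z j \<noteq> 0}. 1)"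
    by simp
  also have "\<dots> \<le> (\<Sum>j\<in>{j \<in> J. z j \<noteq> 0}. (z j)\<^sup>2)"
    by (intro sum_mono) (simp add: int_one_le_iff_zero_less)
  also have "\<dots> \<le> (\<Sum>j\<in>J. (z j)\<^sup>2)"
    using fin by (intro sum_mono2) auto
  finally have "card {j \<in> J. z j \<noteq> 0} \<le> 8" using squares by simp
  moreover have "card J = card {j \<in> J. z j = 0} + card {j \<in> J. z j \<noteq> 0}"
    using fin by (subst card_Un_disjoint[symmetric]) (auto intro: arg_cong[where f = card])
  ultimately show "card J \<le> card {j \<in> J. z j = 0} + 8" by simp
qed

text \<open>\<open>proots\<close> sees only roots in the field itself; the degree condition is what
  makes the polynomial split.\<close>

lemma monic_eq_prod_list_of_proots:
  fixes p :: "'a :: field poly"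
  assumes "monic p" "proots p = mset es" "degree p = length es"
  shows "p = (\<Prod>e\<leftarrow>es. [:- e, 1:])"
  using assms
proof (induction es arbitrary: p)
  case Nil
  then show ?case by (auto elim!: degree_eq_zeroE)
next
  case (Cons e es)
  have p: "p \<noteq> 0" using Cons.prems(1) by auto
  have "e \<in># proots p" using Cons.prems(2) by simp
  then have "poly p e = 0" using p by simp
  then obtain q where q: "p = [:- e, 1:] * q"
    by (auto simp: poly_eq_0_iff_dvd)
  then have q0: "q \<noteq> 0" using p by auto
  have "monic q" using Cons.prems(1) q by (simp add: lead_coeff_mult del: mult_pCons_left)
  moreover have "proots q = mset es"
    using Cons.prems(2) q q0 by (simp add: proots_mult del: mult_pCons_left)
  moreover have "degree q = length es"
    using Cons.prems(3) q q0 by (simp add: degree_mult_eq del: mult_pCons_left)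
  ultimately show ?case using Cons.IH q by simp
qed

section \<open>Divisibility by 4 of the entries of (S - 1)(S - 3)\<close>

text \<open>Let p i be the product of the off-diagonal entries of row i. Off the diagonal, q i j is
  p i p j - 1 modulo 4, hence 2 exactly when the row signs p i and p j differ. The row norms
  restrict how often that happens, and since 4 does not divide 18 all row signs agree.\<close>

lemma seidel_quadratic_dvd_4:
  fixes t q :: "nat \<Rightarrow> nat \<Rightarrow> int"
  assumes sym: "\<And>i j. i < 18 \<Longrightarrow> j < 18 \<Longrightarrow> t i j = t j i"
    and sign: "\<And>i j. i < 18 \<Longrightarrow> j < 18 \<Longrightarrow> i \<noteq> j \<Longrightarrow> t i j = 1 \<or> t i j = -1"
    and diag: "\<And>i. i < 18 \<Longrightarrow> t i i = 0"
    and q: "\<And>i j. i < 18 \<Longrightarrow> j < 18 \<Longrightarrow>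
      q i j = (\<Sum>k<18. t i k * t k j) - 4 * t i j + (if i = j then 3 else 0)"
    and rows: "\<And>i. i < 18 \<Longrightarrow> (\<Sum>j<18. (q i j)\<^sup>2) = 2400"
    and ij: "i < 18" "j < 18"
  shows "4 dvd q i j"
proof -
  define p where "p = (\<lambda>i. \<Prod>k\<in>{..<18} - {i}. t i k)"
  have p: "p i = 1 \<or> p i = -1" if "i < 18" for i
  proof -
    have "\<forall>k\<in>{..<18} - {i}. \<bar>t i k\<bar> = 1"
      using sign that by fastforce
    then have "\<bar>p i\<bar> = 1"
      by (simp add: p_def abs_prod)
    then show ?thesis by linarith
  qed
  have qp: "4 dvd q i j + 1 - p i * p j" if ij: "i < 18" "j < 18" "i \<noteq> j" for i j
  proof -
    \<comment> \<open>The zero diagonal removes k = i and k = j from the sum. The product of the 16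
      remaining terms is p i p j, because t i j t j i = 1.\<close>
    let ?A = "{..<18} - {i} - {j}"
    have "t i k * t k j = 1 \<or> t i k * t k j = -1" if "k \<in> ?A" for k
      using sign[of i k] sign[of k j] that ij by auto
    then have "4 dvd (\<Sum>k\<in>?A. t i k * t k j) - int (card ?A) + 1 - (\<Prod>k\<in>?A. t i k * t k j)"
      by (intro sum_signs_mod_4) auto
    moreover have "card ?A = 16"
      using ij by simp
    moreover have "(\<Sum>k<18. t i k * t k j) = (\<Sum>k\<in>?A. t i k * t k j)"
      using ij diag by (intro sum.mono_neutral_right) auto
    moreover have "p i = t i j * (\<Prod>k\<in>?A. t i k)"
      unfolding p_def using ij by (intro prod.remove) auto
    moreover have "p j = t j i * (\<Prod>k\<in>{..<18} - {j} - {i}. t j k)"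
      unfolding p_def using ij by (intro prod.remove) auto
    moreover have "(\<Prod>k\<in>{..<18} - {j} - {i}. t j k) = (\<Prod>k\<in>?A. t k j)"
      using sym ij by (intro prod.cong) auto
    moreover have "t i j * t j i = 1"
      using sign[of i j] sym[of i j] ij by auto
    ultimately have "4 dvd (q i j + 4 * t i j) - 16 + 1 - p i * p j"
      using q[of i j] ij by (simp add: prod.distrib mult_ac) (simp flip: mult.assoc)
    moreover have "(q i j + 4 * t i j) - 16 + 1 - p i * p j = (q i j + 1 - p i * p j) + 4 * (t i j - 4)"
      by simp
    ultimately show ?thesis
      by (metis dvd_add_left_iff dvd_triv_left)
  qed
  have opposite: "4 dvd card {j. j < 18 \<and> p j \<noteq> p i}" if i: "i < 18" for i
  proof -
    let ?B = "{j. j < 18 \<and> p j \<noteq> p i}"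
    \<comment> \<open>Half of q i j is odd exactly when the row signs differ, so its square modulo 4
      is the indicator of \<open>?B\<close>. The squares add up to 2400 / 4 = 600, a multiple of
      4.\<close>
    have "\<exists>h. q i j = 2 * h \<and> 4 dvd h\<^sup>2 - of_bool (j \<in> ?B)" if j: "j < 18" for j
    proof (cases "i = j")
      case True
      have "(\<Sum>k<18. t i k * t k i) = (\<Sum>k\<in>{..<18} - {i}. 1)"
      proof (intro sum.mono_neutral_cong_right ballI)
        fix k assume "k \<in> {..<18} - {i}"
        then show "t i k * t k i = 1" using sign[of i k] sym[of i k] i by auto
      qed (use diag i in auto)
      then have "q i i = 20" using q[OF i i] diag i by simp
      then show ?thesis using True by (intro exI[of _ 10]) auto
    next
      case False
      show ?thesis
      proof (cases "j \<in> ?B")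
        case True
        then have "p i * p j = -1" using p[OF i] p[OF j] by auto
        then have "4 dvd q i j + 2" using qp[OF i j False] by (simp add: add.commute)
        then obtain m where "q i j + 2 = 4 * m" by (auto elim: dvdE)
        then have "q i j = 2 * (2 * m - 1)" by simp
        then show ?thesis
          using True by (intro exI[of _ "2 * m - 1"]) (auto simp: power2_eq_square algebra_simps)
      next
        case False': False
        then have "p i * p j = 1" using p[OF i] j by auto
        then have "4 dvd q i j" using qp[OF i j False] by simp
        then obtain m where "q i j = 4 * m" by (auto elim: dvdE)
        then show ?thesis
          using False' by (intro exI[of _ "2 * m"]) (auto simp: power2_eq_square)
      qed
    qed
    then obtain h where h: "\<And>j. j < 18 \<Longrightarrow> q i j = 2 * h j"
      "\<And>j. j < 18 \<Longrightarrow> 4 dvd (h j)\<^sup>2 - of_bool (j \<in> ?B)" by metis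
    have "(\<Sum>j<18. (q i j)\<^sup>2) = 4 * (\<Sum>j<18. (h j)\<^sup>2)"
      unfolding sum_distrib_left by (intro sum.cong) (auto simp: h(1) power2_eq_square)
    then have "(\<Sum>j<18. (h j)\<^sup>2) = 600"
      using rows[OF i] by simp
    moreover have "4 dvd (\<Sum>j<18. (h j)\<^sup>2 - of_bool (j \<in> ?B))"
      using h(2) by (intro dvd_sum) auto
    moreover have "(\<Sum>j<18. of_bool (j \<in> ?B) :: int) = int (card ?B)"
    proof -
      have "{..<18} \<inter> ?B = ?B" by auto
      then show ?thesis by (simp add: of_bool_def sum.If_cases del: mem_Collect_eq)
    qed
    ultimately have "4 dvd 600 - int (card ?B)"
      by (simp add: sum_subtractf)
    then show ?thesis by presburger
  qed
  have const: "p i = p j" if ij: "i < 18" "j < 18" for i j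
  proof (rule ccontr)
    assume "p i \<noteq> p j"
    \<comment> \<open>If both signs occurred, the rows opposite to i and those opposite to j would
      partition all 18 rows into two sets of size divisible by 4.\<close>
    then have "{k. k < 18 \<and> p k \<noteq> p i} \<union> {k. k < 18 \<and> p k \<noteq> p j} = {..<18}"
      by auto
    moreover have "{k. k < 18 \<and> p k \<noteq> p i} \<inter> {k. k < 18 \<and> p k \<noteq> p j} = {}"
    proof -
      have "p k = p i \<or> p k = p j" if "k < 18" for k
        using p[OF that] p[OF ij(1)] p[OF ij(2)] \<open>p i \<noteq> p j\<close> by auto
      then show ?thesis by blast
    qed
    ultimately have "card {k. k < 18 \<and> p k \<noteq> p i} + card {k. k < 18 \<and> p k \<noteq> p j} = 18"
      by (subst card_Un_disjoint[symmetric]) auto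
    moreover have "4 dvd card {k. k < 18 \<and> p k \<noteq> p i} + card {k. k < 18 \<and> p k \<noteq> p j}"
      using opposite ij by (intro dvd_add) auto
    ultimately show False by simp
  qed
  show ?thesis
  proof (cases "i = j")
    case True
    have "(\<Sum>k<18. t i k * t k i) = (\<Sum>k\<in>{..<18} - {i}. 1)"
    proof (intro sum.mono_neutral_cong_right ballI)
      fix k assume "k \<in> {..<18} - {i}"
      then show "t i k * t k i = 1" using sign[of i k] sym[of i k] ij by auto
    qed (use diag ij in auto)
    then show ?thesis using q[OF ij] diag ij True by simp
  next
    case False
    have "p i * p j = 1" using const[OF ij] p[OF ij(1)] by auto
    then show ?thesis using qp[OF ij False] by simp
  qed
qed

section \<open>Contradiction from the integral Gram vectors\<close>

text \<open>For each of the three w, \<open>pr w\<close> is five times the projection of w to the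
  plane orthogonal to v, as 3 / 5 is the ratio of v.w to v.v. The scaled projections have squared
  norm 80 and inner products such as 25 x - 45; dividing their Gram determinant by 125 gives the
  equation.\<close>

lemma gram_equation:
  fixes v w1 w2 w3 :: "nat \<Rightarrow> real" and x y z :: int
  defines "ip \<equiv> \<lambda>x y. \<Sum>a<3. x a * y a"
  assumes v: "ip v v = 5" and vw: "ip v w1 = 3" "ip v w2 = 3" "ip v w3 = 3"
    and ww: "ip w1 w1 = 5" "ip w2 w2 = 5" "ip w3 w3 = 5"
    and xyz: "ip w1 w2 = of_int x" "ip w1 w3 = of_int y" "ip w2 w3 = of_int z"
  shows "4096 + 2 * (5 * x - 9) * (5 * y - 9) * (5 * z - 9)
      = 16 * ((5 * x - 9)\<^sup>2 + (5 * y - 9)\<^sup>2 + (5 * z - 9)\<^sup>2)"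
proof -
  define pr where "pr = (\<lambda>w a. 5 * w a - 3 * v a)"
  have ip: "(\<Sum>a<3. w a * w' a) = ip w w'" for w w'
    by (simp add: ip_def)
  have ip_pr: "ip (pr w) (pr w') = 25 * ip w w' - 15 * ip v w - 15 * ip v w' + 9 * ip v v" for w w'
    by (simp add: ip_def pr_def eval_nat_numeral algebra_simps)
  have ip_v_pr: "ip v (pr w) = 5 * ip v w - 3 * ip v v" for w
    by (simp add: ip_def pr_def eval_nat_numeral algebra_simps)
  have "ip (pr w1) (pr w1) * ip (pr w2) (pr w2) * ip (pr w3) (pr w3)
      + 2 * ip (pr w1) (pr w2) * ip (pr w1) (pr w3) * ip (pr w2) (pr w3)
      - ip (pr w1) (pr w1) * (ip (pr w2) (pr w3))\<^sup>2 - ip (pr w2) (pr w2) * (ip (pr w1) (pr w3))\<^sup>2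
      - ip (pr w3) (pr w3) * (ip (pr w1) (pr w2))\<^sup>2 = 0"
    unfolding ip_def
    by (rule planar_gram_det[of v 5]) (simp_all add: ip v vw ip_v_pr)
  then have "real_of_int (80 * 80 * 80 + 2 * (25 * x - 45) * (25 * y - 45) * (25 * z - 45)
      - 80 * (25 * z - 45)\<^sup>2 - 80 * (25 * y - 45)\<^sup>2 - 80 * (25 * x - 45)\<^sup>2) = of_int 0"
    unfolding ip_pr v vw ww xyz by simp
  then have "80 * 80 * 80 + 2 * (25 * x - 45) * (25 * y - 45) * (25 * z - 45)
      - 80 * (25 * z - 45)\<^sup>2 - 80 * (25 * y - 45)\<^sup>2 - 80 * (25 * x - 45)\<^sup>2 = 0"
    by (simp only: of_int_eq_iff)
  then show ?thesis by (simp add: power2_eq_square algebra_simps)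
qed

lemma signed_gram_row:
  fixes t l :: "nat \<Rightarrow> int"
  assumes i: "i < n"
    and sign: "\<And>j. j < n \<Longrightarrow> j \<noteq> i \<Longrightarrow> t j = 1 \<or> t j = -1" "t i = 0"
    and bound: "\<And>j. j < n \<Longrightarrow> j \<noteq> i \<Longrightarrow> \<bar>l j + 3 * t j\<bar> \<le> 2"
    and n: "n = 18" and l: "l i = 5" "(\<Sum>j<n. (l j)\<^sup>2) = 150" "(\<Sum>j<n. t j * l j) = -45"
  shows "\<And>j. j < n \<Longrightarrow> j \<noteq> i \<Longrightarrow> l j \<in> {-4..4} - {0}"
    and "9 \<le> card {j \<in> {..<n} - {i}. l j = -3 * t j}"
proof -
  define J where "J = {..<n} - {i}"
  \<comment> \<open>The deviation of - t j l j from 3. Over the 17 indices it sums to 45 - 51 = -6,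
    and its squares to 125 - 270 + 153 = 8. So at least 17 - 8 = 9 deviations vanish, and values
    from -2 to 1 put - t j l j between 1 and 4.\<close>
  define z where "z = (\<lambda>j. - (t j * l j) - 3)"
  have J: "finite J" "card J = 17" "\<And>j. j \<in> J \<Longrightarrow> j < n \<and> j \<noteq> i"
    using i n by (auto simp: J_def)
  have bz: "\<bar>z j\<bar> \<le> 2" if "j \<in> J" for j
    using sign(1)[of j] bound[of j] J(3)[OF that] by (auto simp: z_def)
  have "(\<Sum>j<n. t j * l j) = (\<Sum>j\<in>J. t j * l j)"
    using i sign(2) by (simp add: J_def sum.remove[of _ i])
  then have lin: "(\<Sum>j\<in>J. t j * l j) = -45" using l by simp
  have "(\<Sum>j<n. (l j)\<^sup>2) = 25 + (\<Sum>j\<in>J. (l j)\<^sup>2)"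
    using i l(1) by (simp add: J_def sum.remove[of _ i])
  then have quad: "(\<Sum>j\<in>J. (l j)\<^sup>2) = 125" using l by simp
  have s: "(\<Sum>j\<in>J. z j) = -6"
    using lin J by (simp add: z_def sum_subtractf sum_negf)
  have "(\<Sum>j\<in>J. (z j)\<^sup>2) = (\<Sum>j\<in>J. (l j)\<^sup>2 + 6 * (t j * l j) + 9)"
  proof (rule sum.cong)
    fix j assume "j \<in> J"
    then show "(z j)\<^sup>2 = (l j)\<^sup>2 + 6 * (t j * l j) + 9"
      using sign(1)[of j] J(3)[of j] by (auto simp: z_def power2_eq_square algebra_simps)
  qed simp
  also have "\<dots> = 8"
    using lin quad J by (simp add: sum.distrib flip: sum_distrib_left)
  finally have s2: "(\<Sum>j\<in>J. (z j)\<^sup>2) = 8" .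
  note dev = many_deviations_zero[OF J(1) bz s s2]
  show "l j \<in> {-4..4} - {0}" if "j < n" "j \<noteq> i" for j
    using sign(1)[OF that] bz[of j] dev(1)[of j] that by (auto simp: z_def J_def)
  have "{j \<in> J. z j = 0} \<subseteq> {j \<in> {..<n} - {i}. l j = -3 * t j}"
  proof safe
    fix j assume "j \<in> J" "z j = 0"
    then show "l j = -3 * t j" "j < n" using sign(1)[of j] J(3)[of j] by (auto simp: z_def)
  qed (auto simp: J_def)
  then have "card {j \<in> J. z j = 0} \<le> card {j \<in> {..<n} - {i}. l j = -3 * t j}"
    by (intro card_mono) auto
  then show "9 \<le> card {j \<in> {..<n} - {i}. l j = -3 * t j}"
    using dev(2) J(2) by simp
qed

lemma no_signed_gram:
  fixes t l :: "nat \<Rightarrow> nat \<Rightarrow> int" and g :: "nat \<Rightarrow> nat \<Rightarrow> real"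
  assumes sign: "\<And>i j. i < 18 \<Longrightarrow> j < 18 \<Longrightarrow> i \<noteq> j \<Longrightarrow> t i j = 1 \<or> t i j = -1"
    and diag: "\<And>i. i < 18 \<Longrightarrow> t i i = 0"
    and gram: "\<And>i j. i < 18 \<Longrightarrow> j < 18 \<Longrightarrow> (\<Sum>a<3. g i a * g j a) = of_int (l i j)"
    and l: "\<And>i. i < 18 \<Longrightarrow> l i i = 5" "\<And>i. i < 18 \<Longrightarrow> (\<Sum>j<18. (l i j)\<^sup>2) = 150"
      "\<And>i. i < 18 \<Longrightarrow> (\<Sum>j<18. t i j * l i j) = -45"
    and bound: "\<And>i j. i < 18 \<Longrightarrow> j < 18 \<Longrightarrow> i \<noteq> j \<Longrightarrow> \<bar>l i j + 3 * t i j\<bar> \<le> 2"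
  shows False
proof -
  have range: "l i j \<in> {-4..4} - {0}" if "i < 18" "j < 18" "j \<noteq> i" for i j
    using that sign diag l bound by (intro signed_gram_row(1)[of i 18 "t i" "l i" j]) auto
  define K where "K = {j \<in> {..<18} - {0 :: nat}. l 0 j = -3 * t 0 j}"
  have "9 \<le> card K"
    unfolding K_def using sign diag l bound by (intro signed_gram_row(2)) auto
  moreover have "card K \<le> 4"
  proof (rule card_le_4_if_one_per_triple)
    show "finite K" by (simp add: K_def)
    fix k1 k2 k3 assume K: "k1 \<in> K" "k2 \<in> K" "k3 \<in> K" and dist: "distinct [k1, k2, k3]"
    \<comment> \<open>The sign - t 0 k makes the inner product of \<open>w k\<close> with
      \<open>g 0\<close> equal to 3 for k in \<open>K\<close>. The new inner products x k m agree
      with l k m up to sign, so they stay in the symmetric range.\<close>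
    define x where "x = (\<lambda>k m. t 0 k * t 0 m * l k m)"
    define w where "w = (\<lambda>k a. - of_int (t 0 k) * g k a)"
    have k18: "k < 18" and t1: "t 0 k = 1 \<or> t 0 k = -1" if "k \<in> K" for k
      using that sign[of 0 k] by (auto simp: K_def)
    have tt: "t 0 k * t 0 k = 1" if "k \<in> K" for k
      using t1[OF that] by auto
    have ip_ww: "(\<Sum>a<3. w k a * w m a) = of_int (x k m)" if "k \<in> K" "m \<in> K" for k m
    proof -
      have "(\<Sum>a<3. w k a * w m a) = of_int (t 0 k * t 0 m) * (\<Sum>a<3. g k a * g m a)"
        unfolding sum_distrib_left by (simp add: w_def mult_ac)
      then show ?thesis using gram k18 that by (simp add: x_def)
    qed
    have ip_w: "(\<Sum>a<3. w k a * w k a) = 5" if "k \<in> K" for k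
      using ip_ww[OF that that] tt[OF that] l(1) k18 that by (simp add: x_def)
    have ip_gw: "(\<Sum>a<3. g 0 a * w k a) = 3" if "k \<in> K" for k
    proof -
      have "(\<Sum>a<3. g 0 a * w k a) = - of_int (t 0 k) * (\<Sum>a<3. g 0 a * g k a)"
        unfolding sum_distrib_left by (simp add: w_def mult_ac)
      also have "\<dots> = of_int (3 * (t 0 k * t 0 k))"
        using gram[of 0 k] k18[OF that] that by (simp add: K_def)
      finally show ?thesis using tt[OF that] by simp
    qed
    have xr: "x k m \<in> {-4..4} - {0}" if "k \<in> K" "m \<in> K" "k \<noteq> m" for k m
    proof -
      have "x k m = l k m \<or> x k m = - l k m"
        using t1[OF that(1)] t1[OF that(2)] unfolding x_def by auto
      then show ?thesis
        using range[OF k18[OF that(1)] k18[OF that(2)]] that(3) by auto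
    qed
    show "of_bool (x k1 k2 = -1) + of_bool (x k1 k3 = -1) + of_bool (x k2 k3 = -1) = (1 :: int)"
    proof (rule planar_triple)
      show "4096 + 2 * (5 * x k1 k2 - 9) * (5 * x k1 k3 - 9) * (5 * x k2 k3 - 9)
          = 16 * ((5 * x k1 k2 - 9)\<^sup>2 + (5 * x k1 k3 - 9)\<^sup>2 + (5 * x k2 k3 - 9)\<^sup>2)"
        by (rule gram_equation[of "g 0" "w k1" "w k2" "w k3"])
          (use K ip_ww ip_w ip_gw gram[of 0 0] l(1)[of 0] in auto)
    qed (use xr K dist in auto)
  qed
  ultimately show False by simp
qed

section \<open>From the spectrum to the Gram vectors\<close>

theorem theorem4p7:
  shows "\<not> (\<exists>S. seidel_matrix 18 S \<and>
    spectrum_mset S =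
      replicate_mset 3 (-9) + replicate_mset 9 1 + replicate_mset 6 3)"
proof
  assume "\<exists>S. seidel_matrix 18 S \<and>
    spectrum_mset S = replicate_mset 3 (-9) + replicate_mset 9 1 + replicate_mset 6 3"
  then obtain S where seidel: "seidel_matrix 18 S"
    and spec: "spectrum_mset S = replicate_mset 3 (-9) + replicate_mset 9 1 + replicate_mset 6 3"
    by blast
  have S: "S \<in> carrier_mat 18 18" "transpose_mat S = S"
    using seidel by (auto simp: seidel_matrix_def)
  define es :: "real list" where "es = replicate 3 (-9) @ replicate 9 1 @ replicate 6 3"
  \<comment> \<open>The multiplicities 3 + 9 + 6 exhaust the degree 18.\<close>
  have "char_poly S = (\<Prod>e\<leftarrow>es. [:- e, 1:])"
    using degree_monic_char_poly[OF S(1)] spec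
    by (intro monic_eq_prod_list_of_proots) (auto simp: spectrum_mset_def es_def)
  then obtain U where U: "U \<in> carrier_mat 18 18" "transpose_mat U * U = 1\<^sub>m 18"
    and SU: "S = U * mat_diag 18 (\<lambda>i. es ! i) * transpose_mat U"
    using symmetric_mat_orthogonally_diagonalizable[OF S] by blast
  have UU: "U * transpose_mat U = 1\<^sub>m 18"
    using U by (intro mat_mult_left_right_inverse[of "transpose_mat U" 18]) auto
  define u where "u = (\<lambda>i k. U $$ (i, k))"
  define d where "d = (\<lambda>k. es ! k)"
  \<comment> \<open>\<open>F f\<close> is U diag(f) U^T. Products and linear combinations act
    pointwise on f, so identities between polynomials in S reduce to a check at the three
    eigenvalues.\<close>
  define F where "F = (\<lambda>f i j. \<Sum>k<18. f k * u i k * u j k)"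
  have cols: "(\<Sum>i<18. u i k * u i m) = (if k = m then 1 else 0)" if "k < 18" "m < 18" for k m
    using arg_cong[OF U(2), of "\<lambda>M. M $$ (k, m)"] that U(1)
    by (simp add: scalar_prod_def atLeast0LessThan u_def)
  have rows: "F (\<lambda>_. 1) i j = (if i = j then 1 else 0)" if "i < 18" "j < 18" for i j
    using arg_cong[OF UU, of "\<lambda>M. M $$ (i, j)"] that U(1)
    by (simp add: scalar_prod_def atLeast0LessThan u_def F_def)
  have SF: "S $$ (i, j) = F d i j" if "i < 18" "j < 18" for i j
  proof -
    have "U * mat_diag 18 (\<lambda>i. es ! i) = mat 18 18 (\<lambda>(i, k). U $$ (i, k) * es ! k)"
      using U(1) by (rule mat_diag_mult_right)
    then show ?thesis
      unfolding SU using that U(1)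
      by (simp add: scalar_prod_def atLeast0LessThan u_def d_def F_def mult_ac)
  qed
  have mult: "(\<Sum>m<18. F f i m * F f' m j) = F (\<lambda>k. f k * f' k) i j" for f f' i j
  proof -
    have "(\<Sum>m<18. F f i m * F f' m j)
        = (\<Sum>m<18. \<Sum>k<18. \<Sum>k'<18. f k * u i k * f' k' * u j k' * (u m k * u m k'))"
      unfolding F_def sum_product by (simp add: mult_ac)
    also have "\<dots> = (\<Sum>k<18. \<Sum>k'<18. \<Sum>m<18. f k * u i k * f' k' * u j k' * (u m k * u m k'))"
      by (subst sum.swap, rule sum.cong[OF refl], rule sum.swap)
    also have "\<dots> = (\<Sum>k<18. \<Sum>k'<18. if k = k' then f k * u i k * f' k' * u j k' else 0)"
      by (intro sum.cong refl) (simp add: cols flip: sum_distrib_left)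
    also have "\<dots> = F (\<lambda>k. f k * f' k) i j"
      by (simp add: F_def mult_ac)
    finally show ?thesis .
  qed
  have Fsym: "F f i j = F f j i" for f i j
    by (simp add: F_def mult_ac)
  have add: "F f i j + c * F f' i j = F (\<lambda>k. f k + c * f' k) i j" for f f' c i j
    by (simp add: F_def sum.distrib sum_distrib_left algebra_simps)
  have scale: "c * F f i j = F (\<lambda>k. c * f k) i j" for f c i j
    by (simp add: F_def sum_distrib_left mult_ac)
  have cong: "F f i j = F f' i j" if "\<And>k. k < 18 \<Longrightarrow> f k = f' k" for f f' i j
    using that by (simp add: F_def)
  have d: "d k = (if k < 3 then -9 else if k < 12 then 1 else 3)" if "k < 18" for k
    using that by (auto simp: d_def es_def nth_append)
  \<comment> \<open>All entries are -1, 0 or 1, so rounding down transfers S to the integers without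
    loss.\<close>
  define t where "t = (\<lambda>i j. \<lfloor>S $$ (i, j)\<rfloor>)"
  have tS: "of_int (t i j) = F d i j" if "i < 18" "j < 18" for i j
  proof -
    have "S $$ (i, j) = 0 \<or> S $$ (i, j) = 1 \<or> S $$ (i, j) = -1"
      using seidel that unfolding seidel_matrix_def by blast
    then have "\<exists>n :: int. S $$ (i, j) = of_int n"
      by (metis of_int_0 of_int_1 of_int_minus)
    then have "of_int (t i j) = S $$ (i, j)"
      by (auto simp: t_def)
    then show ?thesis using SF[OF that] by simp
  qed
  have t_sym: "t i j = t j i" if "i < 18" "j < 18" for i j
  proof -
    have "real_of_int (t i j) = of_int (t j i)"
      using tS[of i j] tS[of j i] Fsym[of d i j] that by simp
    then show ?thesis by (simp only: of_int_eq_iff)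
  qed
  have t_diag: "t i i = 0" if "i < 18" for i
    using seidel that by (simp add: t_def seidel_matrix_def)
  have t_sign: "t i j = 1 \<or> t i j = -1" if "i < 18" "j < 18" "i \<noteq> j" for i j
  proof -
    have "S $$ (i, j) = 1 \<or> S $$ (i, j) = -1"
      using seidel that unfolding seidel_matrix_def by blast
    then show ?thesis by (auto simp: t_def floor_eq_iff)
  qed
  define q where "q = (\<lambda>i j. (\<Sum>k<18. t i k * t k j) - 4 * t i j + (if i = j then 3 else 0))"
  \<comment> \<open>The polynomial (x - 1)(x - 3) is 120 at -9 and vanishes at 1 and 3.\<close>
  define P where "P = F (\<lambda>k. if k < 3 then 120 else 0)"
  have qP: "of_int (q i j) = P i j" if ij: "i < 18" "j < 18" for i j
  proof -
    have "real_of_int (q i j)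
        = F (\<lambda>k. d k * d k) i j + (-4) * F d i j + 3 * F (\<lambda>_. 1) i j"
      using ij by (simp add: q_def tS rows flip: mult)
    also have "\<dots> = P i j"
      unfolding add P_def by (rule cong) (simp add: d)
    finally show ?thesis .
  qed
  have PP: "(\<Sum>m<18. P i m * P m j) = 120 * P i j" for i j
    unfolding P_def mult unfolding scale by (rule cong) simp
  have q_diag: "q i i = 20" if i: "i < 18" for i
  proof -
    have "(\<Sum>k<18. t i k * t k i) = (\<Sum>k\<in>{..<18} - {i}. 1)"
    proof (intro sum.mono_neutral_cong_right ballI)
      fix k assume "k \<in> {..<18} - {i}"
      then show "t i k * t k i = 1" using t_sym[of i k] t_sign[of i k] i by auto
    qed (use t_diag i in auto)
    then show ?thesis using t_diag i by (simp add: q_def)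
  qed
  have q_rows: "(\<Sum>j<18. (q i j)\<^sup>2) = 2400" if i: "i < 18" for i
  proof -
    have "real_of_int (\<Sum>j<18. (q i j)\<^sup>2) = (\<Sum>m<18. P i m * P m i)"
      using i by (simp add: qP power2_eq_square P_def) (simp add: Fsym)
    also have "\<dots> = of_int (120 * q i i)"
      unfolding PP using qP[OF i i] by simp
    finally show ?thesis using q_diag[OF i] by linarith
  qed
  have "4 dvd q i j" if "i < 18" "j < 18" for i j
    using t_sym t_sign t_diag q_rows that by (intro seidel_quadratic_dvd_4[of t q]) (simp_all add: q_def)
  define l where "l = (\<lambda>i j. q i j div 4)"
  have ql: "q i j = 4 * l i j" if "i < 18" "j < 18" for i j
    using that \<open>\<And>i j. i < 18 \<Longrightarrow> j < 18 \<Longrightarrow> 4 dvd q i j\<close> by (simp add: l_def)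
  \<comment> \<open>This is L + 3 S - 3, with L = P / 4: its eigenvalues are 30 - 27 - 3 = 0, 0 + 3
    - 3 = 0 and 0 + 9 - 3 = 6.\<close>
  define R where "R = F (\<lambda>k. if k < 12 then 0 else 6)"
  have R: "R i j = of_int (l i j + 3 * t i j - (if i = j then 3 else 0))" if "i < 18" "j < 18" for i j
  proof -
    have "real_of_int (l i j + 3 * t i j - (if i = j then 3 else 0))
      = (1/4) * P i j + 3 * F d i j + (-3) * F (\<lambda>_. 1) i j"
      using ql[OF that] qP[OF that] tS[OF that] rows[OF that] by (cases "i = j") simp_all
    also have "\<dots> = R i j"
      unfolding P_def scale[of "1/4"] add R_def by (rule cong) (simp add: d)
    finally show ?thesis by simp
  qed
  have l_diag: "l i i = 5" if "i < 18" for i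
    using ql[OF that that] q_diag[OF that] by simp
  show False
  \<comment> \<open>L is 30 times the projection onto the span of the first three columns of U,
    whence the factor sqrt 30.\<close>
  proof (rule no_signed_gram[of t "\<lambda>i k. sqrt 30 * u i k" l])
    fix i j :: nat assume i: "i < 18" and j: "j < 18"
    have "P i j = 120 * (\<Sum>k<3. u i k * u j k)"
      unfolding P_def F_def sum_distrib_left by (intro sum.mono_neutral_cong_right) auto
    moreover have "(\<Sum>k<3. sqrt 30 * u i k * (sqrt 30 * u j k)) = 30 * (\<Sum>k<3. u i k * u j k)"
      unfolding sum_distrib_left by (simp add: mult_ac)
    ultimately show "(\<Sum>k<3. sqrt 30 * u i k * (sqrt 30 * u j k)) = of_int (l i j)"
      using ql[OF i j] qP[OF i j] by simp
    show "\<bar>l i j + 3 * t i j\<bar> \<le> 2" if "i \<noteq> j"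
    proof -
      have RR: "(\<Sum>m<18. R a m * R b m) = 6 * R a b" for a b
        unfolding Fsym[of _ b] R_def mult unfolding scale by (rule cong) simp
      \<comment> \<open>As R^2 = 6 R, the quadratic form of R at e_i + c e_j is a sixth of a sum of
        squares. With diagonal entries 2, taking c = 1 and c = -1 bounds the off-diagonal entry by
        2.\<close>
      have psd: "0 \<le> R i i + 2 * c * R i j + c * c * R j j" for c
      proof -
        have "0 \<le> (\<Sum>m<18. (R i m + c * R j m)\<^sup>2)"
          by (intro sum_nonneg) simp
        also have "\<dots> = (\<Sum>m<18. R i m * R i m + 2 * c * (R i m * R j m) + c * c * (R j m * R j m))"
          by (intro sum.cong) (simp_all add: power2_eq_square algebra_simps)
        also have "\<dots> = 6 * (R i i + 2 * c * R i j + c * c * R j j)"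
          by (simp only: sum.distrib sum_distrib_left[symmetric] RR) (simp add: algebra_simps)
        finally show ?thesis by (simp only: zero_le_mult_iff) simp
      qed
      have "R i i = 2" "R j j = 2"
        using R[OF i i] R[OF j j] l_diag t_diag i j by simp_all
      moreover have Rij: "R i j = of_int (l i j + 3 * t i j)"
        using R[OF i j] that by simp
      ultimately have "\<bar>real_of_int (l i j + 3 * t i j)\<bar> \<le> of_int 2"
        using psd[of 1] psd[of "-1"] by simp
      then show ?thesis
        by (simp only: of_int_abs[symmetric] of_int_le_iff)
    qed
  next
    fix i :: nat assume i: "i < 18"
    have "16 * (\<Sum>j<18. (l i j)\<^sup>2) = (\<Sum>j<18. (q i j)\<^sup>2)"
      unfolding sum_distrib_left using ql i by (intro sum.cong) auto
    then show "(\<Sum>j<18. (l i j)\<^sup>2) = 150" using q_rows[OF i] by simp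
    have "real_of_int (\<Sum>j<18. t i j * (4 * l i j)) = (\<Sum>j<18. F d i j * P j i)"
      unfolding of_int_sum
    proof (rule sum.cong)
      fix j assume "j \<in> {..<18 :: nat}"
      then show "real_of_int (t i j * (4 * l i j)) = F d i j * P j i"
        using ql[of i j] qP[of i j] tS[of i j] Fsym[of _ j i] i by (simp add: P_def)
    qed simp
    \<comment> \<open>S acts as -9 on the range of P, and -9 * 20 = -180 is four times -45.\<close>
    also have "\<dots> = (-9) * P i i"
      unfolding P_def mult unfolding scale by (rule cong) (simp add: d)
    also have "\<dots> = of_int (-180)"
      using qP[OF i i] q_diag[OF i] by simp
    finally have "(\<Sum>j<18. t i j * (4 * l i j)) = -180"
      by (simp only: of_int_eq_iff)
    moreover have "(\<Sum>j<18. t i j * (4 * l i j)) = 4 * (\<Sum>j<18. t i j * l i j)"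
      by (simp add: sum_distrib_left mult_ac)
    ultimately show "(\<Sum>j<18. t i j * l i j) = -45" by simp
  qed (use t_sign t_diag l_diag in auto)
qed

end
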